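(* For $\sigma\in\bigwedge^3V_{10}^\vee$, there exists a flag $V_1\subset V_6\subset V_{10}$ with $\sigma(V_1,V_6,V_{10})=0$ if and only if there exists a flag $V_1\subset V_8\subset V_{10}$ with $\sigma(V_1,V_8,V_8)=0$.
   Context: $V_{10}$ is a $10$-dimensional complex vector space; $V_i$ denotes an $i$-dimensional subspace; $\sigma(A,B,C)=0$ means $\sigma(a,b,c)=0$ for all $a\in A,b\in B,c\in C$. *)

theory Defs
  imports "HOL-Analysis.Analysis"
begin

text \<open>V10 is modelled as complex^10 with complex scalar multiplication (*s);
  complex subspaces and complex dimension are vec.subspace and vec.dim.\<close>

type_synonym V10 = "complex ^ 10"

definition trilinear :: "(V10 \<Rightarrow> V10 \<Rightarrow> V10 \<Rightarrow> complex) \<Rightarrow> bool" where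
  "trilinear \<sigma> \<longleftrightarrow>
     (\<forall>b c. Vector_Spaces.linear (*s) (*) (\<lambda>a. \<sigma> a b c)) \<and>
     (\<forall>a c. Vector_Spaces.linear (*s) (*) (\<lambda>b. \<sigma> a b c)) \<and>
     (\<forall>a b. Vector_Spaces.linear (*s) (*) (\<lambda>c. \<sigma> a b c))"

text \<open>Element of the third exterior power of the dual: alternating trilinear form.\<close>
definition alt3 :: "(V10 \<Rightarrow> V10 \<Rightarrow> V10 \<Rightarrow> complex) \<Rightarrow> bool" where
  "alt3 \<sigma> \<longleftrightarrow> trilinear \<sigma> \<and>
     (\<forall>a b. \<sigma> a a b = 0) \<and> (\<forall>a b. \<sigma> a b a = 0) \<and> (\<forall>a b. \<sigma> b a a = 0)"

definition vanishes_on :: "(V10 \<Rightarrow> V10 \<Rightarrow> V10 \<Rightarrow> complex) \<Rightarrow> V10 set \<Rightarrow> V10 set \<Rightarrow> V10 set \<Rightarrow> bool" where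
  "vanishes_on \<sigma> A B C \<longleftrightarrow> (\<forall>a\<in>A. \<forall>b\<in>B. \<forall>c\<in>C. \<sigma> a b c = 0)"

definition csubspace_dim :: "V10 set \<Rightarrow> nat \<Rightarrow> bool" where
  "csubspace_dim V n \<longleftrightarrow> vec.subspace V \<and> vec.dim V = n"

end

theory Submission
  imports Defs
begin

text \<open>Fix a generator \<open>v\<close> of \<open>V\<^sub>1\<close> and let \<open>\<beta> = \<sigma>(v, -, -)\<close>, an alternating form whose
  radical contains \<open>v\<close>. The first condition says that a six-dimensional subspace through \<open>v\<close>
  lies in the radical of \<open>\<beta>\<close>, the second that an eight-dimensional subspace through \<open>v\<close> is
  \<open>\<beta>\<close>-isotropic. A subspace \<open>W\<close> of the radical of codimension at least 3 grows to an isotropic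
  subspace of dimension \<open>dim W + 2\<close>: adjoin any \<open>x\<^sub>1 \<notin> W\<close>, then any \<open>x\<^sub>2\<close> outside the span with
  \<open>\<beta>(x\<^sub>2, x\<^sub>1) = 0\<close>, which exists because the kernel of \<open>\<beta>(-, x\<^sub>1)\<close> has codimension at most 1.
  Conversely, an isotropic \<open>U\<close> meets the radical in dimension at least \<open>2 dim U - n\<close>, since
  inside \<open>U\<close> the radical is cut out by the \<open>n - dim U\<close> forms \<open>\<beta>(-, c)\<close> with \<open>c\<close> running through
  a complement of \<open>U\<close>.\<close>

interpretation vec_form: vector_space_pair
  "(*s) :: 'a::field \<Rightarrow> 'a ^ 'n \<Rightarrow> 'a ^ 'n" "(*) :: 'a \<Rightarrow> 'a \<Rightarrow> 'a" ..

lemma vec_subspace_dim_1_eq_span_singleton: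
  fixes V :: "('a::field ^ 'n) set"
  assumes "vec.subspace V" "vec.dim V = 1"
  obtains v where "V = vec.span {v}"
proof -
  obtain B where B: "B \<subseteq> V" "vec.independent B" "V \<subseteq> vec.span B" "card B = vec.dim V"
    by (rule vec.basis_exists)
  have "card B = 1"
    using B(4) assms(2) by simp
  then obtain v where "B = {v}"
    by (rule card_1_singletonE)
  moreover have "vec.span B \<subseteq> V"
    using B(1) assms(1) by (rule vec.span_minimal)
  ultimately show thesis
    using B(3) that by blast
qed

lemma vec_subspace_grow:
  fixes A S :: "('a::field ^ 'n) set"
  assumes "vec.subspace A" "vec.subspace S" "A \<subseteq> S" "vec.dim A < vec.dim S"
  obtains x where "x \<in> S" "A \<subseteq> vec.span (insert x A)" "vec.span (insert x A) \<subseteq> S"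
    "vec.dim (vec.span (insert x A)) = vec.dim A + 1"
proof -
  have "\<not> S \<subseteq> A"
    using assms(4) vec.dim_subset[of S A] by linarith
  then obtain x where x: "x \<in> S" "x \<notin> A"
    by blast
  then have "x \<notin> vec.span A"
    using assms(1) vec.span_eq_iff by blast
  then have "vec.dim (vec.span (insert x A)) = vec.dim A + 1"
    using vec.dim_insert[of x A] by simp
  moreover have "vec.span (insert x A) \<subseteq> S"
    using x(1) assms(2,3) by (intro vec.span_minimal) auto
  moreover have "A \<subseteq> vec.span (insert x A)"
    by (meson subset_insertI vec.span_superset subset_trans)
  ultimately show thesis
    using x(1) that by blast
qed

lemma vec_subspace_extend_dim:
  fixes A S :: "('a::field ^ 'n) set"
  assumes "vec.subspace A" "vec.subspace S" "A \<subseteq> S" "vec.dim A \<le> d" "d \<le> vec.dim S"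
  obtains T where "vec.subspace T" "A \<subseteq> T" "T \<subseteq> S" "vec.dim T = d"
proof -
  have "\<exists>T. vec.subspace T \<and> A \<subseteq> T \<and> T \<subseteq> S \<and> vec.dim T = d"
    using assms(1,3,4)
  proof (induction "d - vec.dim A" arbitrary: A)
    case 0
    then show ?case by auto
  next
    case (Suc k)
    then have "vec.dim A < vec.dim S"
      using assms(5) by linarith
    then obtain x where x: "A \<subseteq> vec.span (insert x A)" "vec.span (insert x A) \<subseteq> S"
      "vec.dim (vec.span (insert x A)) = vec.dim A + 1"
      using vec_subspace_grow[OF Suc.prems(1) assms(2) Suc.prems(2)] by blast
    have "k = d - vec.dim (vec.span (insert x A))" "vec.dim (vec.span (insert x A)) \<le> d"
      using x(3) Suc.hyps(2) by auto
    then obtain T where "vec.subspace T" "vec.span (insert x A) \<subseteq> T" "T \<subseteq> S" "vec.dim T = d"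
      using Suc.hyps(1)[of "vec.span (insert x A)"] vec.subspace_span x(2) by blast
    then show ?case
      using x(1) by blast
  qed
  then show thesis
    using that by blast
qed

lemma dim_kernel_linear_form:
  assumes lin: "Vector_Spaces.linear (*s) (*) (f :: 'a::field ^ 'n \<Rightarrow> 'a)"
  shows "CARD('n) \<le> vec.dim {x. f x = 0} + 1"
proof (cases "\<forall>x. f x = 0")
  case True
  then show ?thesis by (simp add: card_cart_basis)
next
  case False
  then obtain u where u: "f u \<noteq> 0" by blast
  define u' where "u' = (1 / f u) *s u"
  have fu': "f u' = 1"
    using u vec_form.linear_scale[OF lin] by (simp add: u'_def)
  have "UNIV \<subseteq> vec.span (insert u' {x. f x = 0})"
  proof
    fix x :: "'a ^ 'n"
    have "f (x - f x *s u') = 0"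
      using fu' by (simp add: vec_form.linear_diff[OF lin] vec_form.linear_scale[OF lin])
    then show "x \<in> vec.span (insert u' {x. f x = 0})"
      unfolding vec.span_breakdown_eq by (intro exI[of _ "f x"] vec.span_base) simp
  qed
  then have "vec.dim (UNIV :: ('a ^ 'n) set) \<le> vec.dim (vec.span (insert u' {x. f x = 0}))"
    by (rule vec.dim_subset)
  then have "CARD('n) \<le> vec.dim (insert u' {x. f x = 0})"
    by (simp add: card_cart_basis)
  then show ?thesis
    using vec.dim_insert[of u' "{x. f x = 0}"] by (simp split: if_splits)
qed

lemma dim_Int_kernel_linear_form:
  assumes "vec.subspace S" and lin: "Vector_Spaces.linear (*s) (*) (f :: 'a::field ^ 'n \<Rightarrow> 'a)"
  shows "vec.dim S \<le> vec.dim (S \<inter> {x. f x = 0}) + 1"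
proof -
  have "vec.dim {x + y |x y. x \<in> S \<and> y \<in> {x. f x = 0}} \<le> CARD('n)"
    using vec.dim_subset[of _ "UNIV :: ('a ^ 'n) set"] by (simp add: card_cart_basis)
  then show ?thesis
    using vec.dim_sums_Int[OF assms(1) vec_form.linear_subspace_kernel[OF lin]]
      dim_kernel_linear_form[OF lin] by linarith
qed

lemma vec_subspace_complement:
  fixes U :: "('a::field ^ 'n) set"
  assumes "vec.subspace U"
  obtains C where "finite C" "card C + vec.dim U = CARD('n)" "vec.span (U \<union> C) = UNIV"
proof -
  obtain B where B: "B \<subseteq> U" "vec.independent B" "U \<subseteq> vec.span B" "card B = vec.dim U"
    by (rule vec.basis_exists)
  obtain B' where B': "B \<subseteq> B'" "B' \<subseteq> UNIV" "vec.independent B'" "UNIV \<subseteq> vec.span B'"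
    by (rule vec.maximal_independent_subset_extend[OF subset_UNIV B(2)])
  have fin: "finite B'"
    using vec.independent_bound_general[OF B'(3)] by simp
  have "vec.span B' = UNIV"
    using B'(4) by blast
  then have "card B' = CARD('n)"
    using vec.dim_eq_card_independent[OF B'(3)] vec.dim_span[of B'] vec_dim_card by metis
  then have "card (B' - B) + vec.dim U = CARD('n)"
    using B(4) B'(1) fin card_Diff_subset[of B B'] card_mono[of B' B] finite_subset[OF B'(1) fin]
    by linarith
  moreover have "vec.span B' \<subseteq> vec.span (U \<union> (B' - B))"
    using B(1) by (intro vec.span_mono) blast
  then have "vec.span (U \<union> (B' - B)) = UNIV"
    using B'(4) by blast
  ultimately show thesis
    using that fin by blast
qed

definition bilinear_form :: "('a::field ^ 'n \<Rightarrow> 'a ^ 'n \<Rightarrow> 'a) \<Rightarrow> bool" where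
  "bilinear_form \<beta> \<longleftrightarrow>
     (\<forall>y. Vector_Spaces.linear (*s) (*) (\<lambda>x. \<beta> x y)) \<and>
     (\<forall>x. Vector_Spaces.linear (*s) (*) (\<lambda>y. \<beta> x y))"

definition alternating_form :: "('a::field ^ 'n \<Rightarrow> 'a ^ 'n \<Rightarrow> 'a) \<Rightarrow> bool" where
  "alternating_form \<beta> \<longleftrightarrow> bilinear_form \<beta> \<and> (\<forall>x. \<beta> x x = 0)"

definition isotropic :: "('a \<Rightarrow> 'a \<Rightarrow> 'b::zero) \<Rightarrow> 'a set \<Rightarrow> bool" where
  "isotropic \<beta> W \<longleftrightarrow> (\<forall>x\<in>W. \<forall>y\<in>W. \<beta> x y = 0)"

definition radical :: "('a \<Rightarrow> 'a \<Rightarrow> 'b::zero) \<Rightarrow> 'a set" where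
  "radical \<beta> = {x. \<forall>y. \<beta> x y = 0}"

lemma bilinear_formD:
  assumes "bilinear_form \<beta>"
  shows "Vector_Spaces.linear (*s) (*) (\<lambda>x. \<beta> x y)" "Vector_Spaces.linear (*s) (*) (\<beta> x)"
  using assms unfolding bilinear_form_def by auto

lemma alternating_form_skew:
  assumes "alternating_form \<beta>"
  shows "\<beta> y x = - \<beta> x y"
proof -
  have bil: "bilinear_form \<beta>" and alt: "\<And>x. \<beta> x x = 0"
    using assms unfolding alternating_form_def by auto
  have "0 = \<beta> (x + y) (x + y)"
    using alt by simp
  also have "\<dots> = \<beta> x x + \<beta> x y + (\<beta> y x + \<beta> y y)"
    by (simp add: vec_form.linear_add[OF bilinear_formD(1)[OF bil]]
        vec_form.linear_add[OF bilinear_formD(2)[OF bil]])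
  finally show ?thesis
    using alt by (simp add: eq_neg_iff_add_eq_0 add.commute)
qed

lemma subspace_left_annihilator:
  assumes "bilinear_form \<beta>"
  shows "vec.subspace {x. \<forall>y\<in>C. \<beta> x y = 0}"
  unfolding vec.subspace_def
  by (simp add: vec_form.linear_0[OF bilinear_formD(1)[OF assms]]
      vec_form.linear_add[OF bilinear_formD(1)[OF assms]]
      vec_form.linear_scale[OF bilinear_formD(1)[OF assms]])

lemma radical_subspace:
  assumes "bilinear_form \<beta>"
  shows "vec.subspace (radical \<beta>)"
  using subspace_left_annihilator[OF assms, of UNIV] by (simp add: radical_def)

lemma isotropic_span:
  assumes "bilinear_form \<beta>" "isotropic \<beta> G"
  shows "isotropic \<beta> (vec.span G)"
proof -
  have "vec.span G \<subseteq> {x. \<forall>y\<in>G. \<beta> x y = 0}"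
    using assms by (intro vec.span_minimal subspace_left_annihilator) (auto simp: isotropic_def)
  then have "G \<subseteq> {y. \<forall>x\<in>vec.span G. \<beta> x y = 0}"
    by blast
  moreover have "vec.subspace {y. \<forall>x\<in>vec.span G. \<beta> x y = 0}"
    using subspace_left_annihilator[of "\<lambda>y x. \<beta> x y"] assms(1)
    unfolding bilinear_form_def by auto
  ultimately have "vec.span G \<subseteq> {y. \<forall>x\<in>vec.span G. \<beta> x y = 0}"
    by (rule vec.span_minimal)
  then show ?thesis
    unfolding isotropic_def by blast
qed

lemma isotropic_extension_of_radical:
  fixes W :: "('a::field ^ 'n) set"
  assumes alt: "alternating_form \<beta>" and W: "vec.subspace W" "W \<subseteq> radical \<beta>"
    and dim: "vec.dim W + 3 \<le> CARD('n)"
  obtains U where "vec.subspace U" "W \<subseteq> U" "vec.dim U = vec.dim W + 2" "isotropic \<beta> U"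
proof -
  have bil: "bilinear_form \<beta>"
    using alt by (simp add: alternating_form_def)
  have "vec.dim W < vec.dim (UNIV :: ('a ^ 'n) set)"
    using dim by (simp add: card_cart_basis)
  then obtain x\<^sub>1 where x\<^sub>1: "W \<subseteq> vec.span (insert x\<^sub>1 W)"
    "vec.dim (vec.span (insert x\<^sub>1 W)) = vec.dim W + 1"
    using vec_subspace_grow[OF W(1) vec.subspace_UNIV] by blast
  define L where "L = vec.span (insert x\<^sub>1 W)"
  define H where "H = {y. \<beta> y x\<^sub>1 = 0}"
  have H: "vec.subspace H" "CARD('n) \<le> vec.dim H + 1"
    unfolding H_def
    using vec_form.linear_subspace_kernel dim_kernel_linear_form bilinear_formD(1)[OF bil] by auto
  have "L \<subseteq> H"
    unfolding L_def using W(2) alt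
    by (intro vec.span_minimal H(1)) (auto simp: H_def radical_def alternating_form_def)
  moreover have "vec.dim L < vec.dim H"
    using x\<^sub>1(2) H(2) dim unfolding L_def by linarith
  ultimately obtain x\<^sub>2 where x\<^sub>2: "x\<^sub>2 \<in> H" "L \<subseteq> vec.span (insert x\<^sub>2 L)"
    "vec.dim (vec.span (insert x\<^sub>2 L)) = vec.dim L + 1"
    using vec_subspace_grow[OF vec.subspace_span H(1)] unfolding L_def by blast
  define G where "G = insert x\<^sub>2 (insert x\<^sub>1 W)"
  have rad_left: "\<beta> w y = 0" and rad_right: "\<beta> y w = 0" if "w \<in> W" for w y
    using that W(2) alternating_form_skew[OF alt, of y w] by (auto simp: radical_def)
  have "\<beta> x\<^sub>2 x\<^sub>1 = 0"
    using x\<^sub>2(1) by (simp add: H_def)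
  moreover have "\<beta> x\<^sub>1 x\<^sub>2 = 0"
    using calculation alternating_form_skew[OF alt, of x\<^sub>1 x\<^sub>2] by simp
  moreover have "\<beta> x x = 0" for x
    using alt by (simp add: alternating_form_def)
  ultimately have "isotropic \<beta> G"
    unfolding G_def isotropic_def using rad_left rad_right by blast
  moreover have "vec.span (insert x\<^sub>2 L) \<subseteq> vec.span G"
    unfolding L_def G_def
    by (intro vec.span_minimal vec.subspace_span insert_subsetI vec.span_base vec.span_mono) auto
  ultimately have "isotropic \<beta> (vec.span (insert x\<^sub>2 L))"
    using isotropic_span[OF bil] unfolding isotropic_def by blast
  moreover have "W \<subseteq> vec.span (insert x\<^sub>2 L)"
    using x\<^sub>1(1) x\<^sub>2(2) unfolding L_def by blast
  ultimately show thesis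
    using that[of "vec.span (insert x\<^sub>2 L)"] x\<^sub>1(2) x\<^sub>2(3) unfolding L_def by simp
qed

lemma dim_isotropic_Int_radical:
  fixes U :: "('a::field ^ 'n) set"
  assumes bil: "bilinear_form \<beta>" and U: "vec.subspace U" "isotropic \<beta> U"
  shows "2 * vec.dim U \<le> vec.dim (U \<inter> radical \<beta>) + CARD('n)"
proof -
  have annihilator: "vec.dim U \<le> vec.dim (U \<inter> {x. \<forall>c\<in>C. \<beta> x c = 0}) + card C"
    if "finite C" for C
    using that
  proof (induction C rule: finite_induct)
    case empty
    then show ?case by simp
  next
    case (insert c C)
    have "U \<inter> {x. \<forall>c'\<in>insert c C. \<beta> x c' = 0}
        = (U \<inter> {x. \<forall>c\<in>C. \<beta> x c = 0}) \<inter> {x. \<beta> x c = 0}"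
      by auto
    moreover have "vec.subspace (U \<inter> {x. \<forall>c\<in>C. \<beta> x c = 0})"
      using U(1) subspace_left_annihilator[OF bil] by (rule vec.subspace_inter)
    ultimately have "vec.dim (U \<inter> {x. \<forall>c\<in>C. \<beta> x c = 0})
        \<le> vec.dim (U \<inter> {x. \<forall>c'\<in>insert c C. \<beta> x c' = 0}) + 1"
      using dim_Int_kernel_linear_form[OF _ bilinear_formD(1)[OF bil]] by (simp only:)
    then show ?case
      using insert by simp
  qed
  obtain C where C: "finite C" "card C + vec.dim U = CARD('n)" "vec.span (U \<union> C) = UNIV"
    using vec_subspace_complement[OF U(1)] by blast
  have "U \<inter> {x. \<forall>c\<in>C. \<beta> x c = 0} \<subseteq> radical \<beta>"
  proof
    fix x assume x: "x \<in> U \<inter> {x. \<forall>c\<in>C. \<beta> x c = 0}"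
    have "vec.span (U \<union> C) \<subseteq> {y. \<beta> x y = 0}"
      using x U(2) unfolding isotropic_def
      by (intro vec.span_minimal vec_form.linear_subspace_kernel[OF bilinear_formD(2)[OF bil]]) auto
    then show "x \<in> radical \<beta>"
      using C(3) by (auto simp: radical_def)
  qed
  then have "vec.dim (U \<inter> {x. \<forall>c\<in>C. \<beta> x c = 0}) \<le> vec.dim (U \<inter> radical \<beta>)"
    by (intro vec.dim_subset) blast
  then show ?thesis
    using annihilator[OF C(1)] C(2) by linarith
qed

lemma alt3_alternating_form:
  assumes "alt3 \<sigma>"
  shows "alternating_form (\<sigma> v)"
  using assms unfolding alt3_def trilinear_def alternating_form_def bilinear_form_def by auto

lemma alt3_span_singleton_subset_radical:
  assumes "alt3 \<sigma>"
  shows "vec.span {v} \<subseteq> radical (\<sigma> v)"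
proof (rule vec.span_minimal)
  show "vec.subspace (radical (\<sigma> v))"
    using alt3_alternating_form[OF assms] by (simp add: alternating_form_def radical_subspace)
  show "{v} \<subseteq> radical (\<sigma> v)"
    using assms by (simp add: alt3_def radical_def)
qed

lemma vanishes_on_span_singleton:
  assumes "trilinear \<sigma>"
  shows "vanishes_on \<sigma> (vec.span {v}) B C \<longleftrightarrow> (\<forall>b\<in>B. \<forall>c\<in>C. \<sigma> v b c = 0)"
proof -
  have "\<sigma> (k *s v) b c = k * \<sigma> v b c" for k b c
    using assms vec_form.linear_scale unfolding trilinear_def by blast
  then show ?thesis
    unfolding vanishes_on_def vec.span_singleton by auto
qed

lemma alt3_radical_extends_to_isotropic:
  assumes "alt3 \<sigma>" "csubspace_dim V1 1" "vec.subspace W" "vec.dim W + 3 \<le> 10"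
    "vanishes_on \<sigma> V1 W UNIV"
  obtains U where "vec.subspace U" "W \<subseteq> U" "vec.dim U = vec.dim W + 2" "vanishes_on \<sigma> V1 U U"
proof -
  obtain v where v: "V1 = vec.span {v}"
    using assms(2) vec_subspace_dim_1_eq_span_singleton unfolding csubspace_dim_def by blast
  have tri: "trilinear \<sigma>"
    using assms(1) by (simp add: alt3_def)
  have "W \<subseteq> radical (\<sigma> v)"
    using assms(5) unfolding v vanishes_on_span_singleton[OF tri] radical_def by blast
  moreover have "vec.dim W + 3 \<le> CARD(10)"
    using assms(4) by simp
  ultimately obtain U where U: "vec.subspace U" "W \<subseteq> U" "vec.dim U = vec.dim W + 2"
    and iso: "isotropic (\<sigma> v) U"
    using isotropic_extension_of_radical[OF alt3_alternating_form[OF assms(1)] assms(3)] by blast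
  have "vanishes_on \<sigma> V1 U U"
    using iso unfolding v vanishes_on_span_singleton[OF tri] isotropic_def by blast
  then show thesis
    by (rule that[OF U])
qed

lemma alt3_isotropic_contains_radical:
  assumes "alt3 \<sigma>" "csubspace_dim V1 1" "vec.subspace U" "V1 \<subseteq> U" "vanishes_on \<sigma> V1 U U"
    "1 \<le> d" "d + 10 \<le> 2 * vec.dim U"
  obtains W where "vec.subspace W" "V1 \<subseteq> W" "vec.dim W = d" "vanishes_on \<sigma> V1 W UNIV"
proof -
  obtain v where v: "V1 = vec.span {v}"
    using assms(2) vec_subspace_dim_1_eq_span_singleton unfolding csubspace_dim_def by blast
  have tri: "trilinear \<sigma>"
    using assms(1) by (simp add: alt3_def)
  have bil: "bilinear_form (\<sigma> v)"
    using alt3_alternating_form[OF assms(1)] by (simp add: alternating_form_def)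
  have "isotropic (\<sigma> v) U"
    using assms(5) unfolding v vanishes_on_span_singleton[OF tri] isotropic_def by blast
  then have dim: "d \<le> vec.dim (U \<inter> radical (\<sigma> v))"
    using dim_isotropic_Int_radical[OF bil assms(3)] assms(7) by simp
  have sub: "V1 \<subseteq> U \<inter> radical (\<sigma> v)"
    using assms(4) alt3_span_singleton_subset_radical[OF assms(1)] unfolding v by blast
  have subspace: "vec.subspace (U \<inter> radical (\<sigma> v))"
    using assms(3) radical_subspace[OF bil] by (rule vec.subspace_inter)
  have V1: "vec.subspace V1" "vec.dim V1 \<le> d"
    using assms(2,6) by (auto simp: csubspace_dim_def)
  obtain W where W: "vec.subspace W" "V1 \<subseteq> W" "W \<subseteq> U \<inter> radical (\<sigma> v)" "vec.dim W = d"
    using vec_subspace_extend_dim[OF V1(1) subspace sub V1(2) dim] by blast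
  have "vanishes_on \<sigma> V1 W UNIV"
    using W(3) unfolding v vanishes_on_span_singleton[OF tri] radical_def by blast
  then show thesis
    by (rule that[OF W(1,2,4)])
qed

theorem lemma4p1:
  fixes \<sigma> :: "V10 \<Rightarrow> V10 \<Rightarrow> V10 \<Rightarrow> complex"
  assumes "alt3 \<sigma>"
  shows "(\<exists>V1 V6. csubspace_dim V1 1 \<and> csubspace_dim V6 6 \<and> V1 \<subseteq> V6 \<and>
            vanishes_on \<sigma> V1 V6 UNIV)
     \<longleftrightarrow> (\<exists>V1 V8. csubspace_dim V1 1 \<and> csubspace_dim V8 8 \<and> V1 \<subseteq> V8 \<and>
            vanishes_on \<sigma> V1 V8 V8)"
proof
  assume "\<exists>V1 V6. csubspace_dim V1 1 \<and> csubspace_dim V6 6 \<and> V1 \<subseteq> V6 \<and>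
            vanishes_on \<sigma> V1 V6 UNIV"
  then obtain V1 V6 where V1: "csubspace_dim V1 1" and V6: "csubspace_dim V6 6"
    and flag: "V1 \<subseteq> V6" "vanishes_on \<sigma> V1 V6 UNIV"
    by blast
  have V6': "vec.subspace V6" "vec.dim V6 + 3 \<le> 10"
    using V6 by (simp_all add: csubspace_dim_def)
  obtain V8 where V8: "vec.subspace V8" "V6 \<subseteq> V8" "vec.dim V8 = vec.dim V6 + 2"
    "vanishes_on \<sigma> V1 V8 V8"
    by (rule alt3_radical_extends_to_isotropic[OF assms V1 V6' flag(2)])
  have "csubspace_dim V8 8"
    using V6 V8(1,3) by (simp add: csubspace_dim_def)
  then show "\<exists>V1 V8. csubspace_dim V1 1 \<and> csubspace_dim V8 8 \<and> V1 \<subseteq> V8 \<and>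
            vanishes_on \<sigma> V1 V8 V8"
    using V1 V8(2,4) flag(1) by blast
next
  assume "\<exists>V1 V8. csubspace_dim V1 1 \<and> csubspace_dim V8 8 \<and> V1 \<subseteq> V8 \<and>
            vanishes_on \<sigma> V1 V8 V8"
  then obtain V1 V8 where V1: "csubspace_dim V1 1" and V8: "csubspace_dim V8 8"
    and flag: "V1 \<subseteq> V8" "vanishes_on \<sigma> V1 V8 V8"
    by blast
  have V8': "vec.subspace V8" and dims: "1 \<le> (6::nat)" "6 + 10 \<le> 2 * vec.dim V8"
    using V8 by (simp_all add: csubspace_dim_def)
  obtain V6 where V6: "vec.subspace V6" "V1 \<subseteq> V6" "vec.dim V6 = 6" "vanishes_on \<sigma> V1 V6 UNIV"
    by (rule alt3_isotropic_contains_radical[OF assms V1 V8' flag dims])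
  have "csubspace_dim V6 6"
    using V6(1,3) by (simp add: csubspace_dim_def)
  then show "\<exists>V1 V6. csubspace_dim V1 1 \<and> csubspace_dim V6 6 \<and> V1 \<subseteq> V6 \<and>
            vanishes_on \<sigma> V1 V6 UNIV"
    using V1 V6(2,4) by blast
qed

end
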